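(* Let $Q$ and $Q+2$ be odd twin prime powers (i.e. both are powers of odd primes), and let $\mathcal{D}$ be the $\frac12(Q+1)^2$-element subset $$\mathcal{D}=(\{0\}\times\mathbb{F}_{Q+2}^\times)\sqcup(\mathcal{S}_Q\times\mathcal{N}_{Q+2})\sqcup(\mathcal{N}_Q\times\mathcal{S}_{Q+2})$$ of the (additive) group $\mathcal{G}=\mathbb{F}_Q\times\mathbb{F}_{Q+2}$, namely the complement of the classical twin prime power difference set. Then $\mathcal{D}$ is a fine difference set, and is an amalgam if and only if $Q\equiv3\bmod4$. Moreover, $\mathcal{D}$ is a composite difference set only when $Q=3$.
   Context: For an odd prime power $Q$, $\mathbb{F}_Q$ is the field of order $Q$, $\mathcal{S}_Q=\{x^2:x\in\mathbb{F}_Q^\times\}$ is its set of nonzero squares, and $\mathcal{N}_Q=\mathbb{F}_Q^\times\setminus\mathcal{S}_Q$ its set of nonsquares. The classical twin prime power difference set is $(\mathbb{F}_Q\times\{0\})\sqcup(\mathcal{S}_Q\times\mathcal{S}_{Q+2})\sqcup(\mathcal{N}_Q\times\mathcal{N}_{Q+2})$. A subset $\mathcal{D}$ of a finite abelian group $\mathcal{G}$ is a difference set for $\mathcal{G}$ if every nonzero $g\in\mathcal{G}$ can be written as a difference of members of $\mathcal{D}$ in the same number of ways (the empty set is trivially a difference set). A nonempty $D$-element difference set $\mathcal{D}$ for $\mathcal{G}$ of order $G$ is $\mathcal{H}$-fine, for a subgroup $\mathcal{H}$ of $\mathcal{G}$, if $\mathcal{D}\cap\mathcal{H}=\emptyset$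 and $\mathcal{H}$ has order $\frac{G}{S+1}$, where $S=\left[\frac{D(G-1)}{G-D}\right]^{1/2}$. It is fine if it is $\mathcal{H}$-fine for some subgroup $\mathcal{H}$. $\mathcal{D}$ is an amalgam if it is $\mathcal{H}$-fine for some subgroup $\mathcal{H}$ of $\mathcal{G}$ and moreover, for every $g\in\mathcal{G}$, $\mathcal{D}_g:=\mathcal{H}\cap(\mathcal{D}-g)$ is a difference set for $\mathcal{H}$. $\mathcal{D}$ is composite if it is $\mathcal{H}$-fine for some subgroup $\mathcal{H}$ of $\mathcal{G}$ and moreover there exist an $S$-element subset $\mathcal{A}$ of $\mathcal{G}$ and a difference set $\mathcal{B}$ for $\mathcal{H}$ such that $\chi_{\mathcal{D}}=\chi_{\mathcal{A}}*\chi_{\mathcal{B}}$, where $\chi$ denotes characteristic functions on $\mathcal{G}$ and $(\mathbf{x}_1*\mathbf{x}_2)(g)=\sum_{g'\in\mathcal{G}}\mathbf{x}_1(g')\mathbf{x}_2(g-g')$. *)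

theory Defs
  imports "HOL-Algebra.Algebra" "HOL-Number_Theory.Prime_Powers" "HOL-Library.Indicator_Function"
begin

text \<open>
  An abelian group \<open>G\<close> is a HOL-Algebra group, written multiplicatively: the difference
  \<open>x - y\<close> is \<open>x \<otimes>\<^bsub>G\<^esub> inv\<^bsub>G\<^esub> y\<close> and the element \<open>0\<close> is \<open>\<one>\<^bsub>G\<^esub>\<close>.
  The definitions are meant for finite abelian \<open>G\<close>. A subgroup \<open>H\<close> is regarded as a group
  in its own right as \<open>G\<lparr>carrier := H\<rparr>\<close>.
\<close>

definition difference_set :: "('g, 'm) monoid_scheme \<Rightarrow> 'g set \<Rightarrow> bool" where
  "difference_set G D \<longleftrightarrow>
     D \<subseteq> carrier G \<and>
     (\<exists>l::nat. \<forall>g \<in> carrier G - {\<one>\<^bsub>G\<^esub>}.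
        card {(x, y). x \<in> D \<and> y \<in> D \<and> x \<otimes>\<^bsub>G\<^esub> inv\<^bsub>G\<^esub> y = g} = l)"

definition fine_parameter :: "('g, 'm) monoid_scheme \<Rightarrow> 'g set \<Rightarrow> real" where
  "fine_parameter G D =
     sqrt (real (card D) * (real (order G) - 1) / (real (order G) - real (card D)))"

text \<open>
  The degenerate case \<open>D = carrier G\<close>, where the quotient in \<open>fine_parameter\<close> has denominator
  zero, is excluded below by \<open>D \<inter> H = {}\<close>.
\<close>

definition fine_wrt :: "('g, 'm) monoid_scheme \<Rightarrow> 'g set \<Rightarrow> 'g set \<Rightarrow> bool" where
  "fine_wrt G H D \<longleftrightarrow>
     difference_set G D \<and> D \<noteq> {} \<and> subgroup H G \<and> D \<inter> H = {} \<and>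
     real (card H) = real (order G) / (fine_parameter G D + 1)"

definition fine :: "('g, 'm) monoid_scheme \<Rightarrow> 'g set \<Rightarrow> bool" where
  "fine G D \<longleftrightarrow> (\<exists>H. fine_wrt G H D)"

definition amalgam :: "('g, 'm) monoid_scheme \<Rightarrow> 'g set \<Rightarrow> bool" where
  "amalgam G D \<longleftrightarrow>
     (\<exists>H. fine_wrt G H D \<and>
       (\<forall>g \<in> carrier G.
          difference_set (G\<lparr>carrier := H\<rparr>) (H \<inter> (D #>\<^bsub>G\<^esub> inv\<^bsub>G\<^esub> g))))"

definition convolution ::
    "('g, 'm) monoid_scheme \<Rightarrow> ('g \<Rightarrow> complex) \<Rightarrow> ('g \<Rightarrow> complex) \<Rightarrow> 'g \<Rightarrow> complex" where
  "convolution G x1 x2 g = (\<Sum>g' \<in> carrier G. x1 g' * x2 (g \<otimes>\<^bsub>G\<^esub> inv\<^bsub>G\<^esub> g'))"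

definition composite :: "('g, 'm) monoid_scheme \<Rightarrow> 'g set \<Rightarrow> bool" where
  "composite G D \<longleftrightarrow>
     (\<exists>H. fine_wrt G H D \<and>
       (\<exists>A B. A \<subseteq> carrier G \<and> real (card A) = fine_parameter G D \<and>
          difference_set (G\<lparr>carrier := H\<rparr>) B \<and>
          (\<forall>g \<in> carrier G. indicator D g = convolution G (indicator A) (indicator B) g)))"

definition nonzero_squares :: "('a, 'm) ring_scheme \<Rightarrow> 'a set" where
  "nonzero_squares F = (\<lambda>x. x [^]\<^bsub>F\<^esub> (2::nat)) ` (carrier F - {\<zero>\<^bsub>F\<^esub>})"

definition nonsquares :: "('a, 'm) ring_scheme \<Rightarrow> 'a set" where
  "nonsquares F = (carrier F - {\<zero>\<^bsub>F\<^esub>}) - nonzero_squares F"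

definition twin_group ::
    "('a, 'm) ring_scheme \<Rightarrow> ('b, 'n) ring_scheme \<Rightarrow> ('a \<times> 'b) monoid" where
  "twin_group F K = add_monoid F \<times>\<times> add_monoid K"

definition classical_twin_set ::
    "('a, 'm) ring_scheme \<Rightarrow> ('b, 'n) ring_scheme \<Rightarrow> ('a \<times> 'b) set" where
  "classical_twin_set F K =
     carrier F \<times> {\<zero>\<^bsub>K\<^esub>} \<union>
     nonzero_squares F \<times> nonzero_squares K \<union>
     nonsquares F \<times> nonsquares K"

definition twin_set ::
    "('a, 'm) ring_scheme \<Rightarrow> ('b, 'n) ring_scheme \<Rightarrow> ('a \<times> 'b) set" where
  "twin_set F K =
     {\<zero>\<^bsub>F\<^esub>} \<times> (carrier K - {\<zero>\<^bsub>K\<^esub>}) \<union>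
     nonzero_squares F \<times> nonsquares K \<union>
     nonsquares F \<times> nonzero_squares K"

end

theory Submission
  imports Defs
begin

text \<open>
  With \<open>\<chi>\<close> and \<open>\<psi>\<close> the quadratic characters of the two fields,
  \<open>2 \<cdot> 1\<^sub>D(x, y) = (1 + \<delta>\<^sub>0(x)) (1 - \<delta>\<^sub>0(y)) - \<chi>(x) \<psi>(y)\<close>, so every autocorrelation of \<open>D\<close>
  factors into one-variable sums; the mixed terms cancel because exactly one of \<open>-1 \<in> F\<close>,
  \<open>-1 \<in> K\<close> is a square. As \<open>Q\<close> and \<open>Q + 2\<close> are coprime, the only candidate for the subgroup is
  \<open>F \<times> {0}\<close>, and its intersections with the translates of \<open>D\<close> are empty or translates of
  \<open>S \<union> {0}\<close> or \<open>N \<union> {0}\<close>, with \<open>S\<close> and \<open>N\<close> the squares and nonsquares of \<open>F\<close>. These have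
  \<open>(Q + 1) / 2\<close> elements, so being a difference set forces
  \<open>4 dvd Q + 1\<close>; conversely they are Paley difference sets when \<open>Q \<equiv> 3 (mod 4)\<close>. If \<open>D\<close> is composite,
  then \<open>S \<union> {0}\<close> and \<open>N \<union> {0}\<close> are both translates of \<open>B\<close>, hence of each other,
  which is impossible for \<open>Q > 3\<close>.
\<close>

section \<open>The quadratic character of a finite field of odd order\<close>

text \<open>Integer values let indicators be expanded without division. Elements outside the carrier
  get the default value \<open>- 1\<close>, so sets defined by a character value must name the
  carrier explicitly.\<close>

definition quad_char :: "('a, 'm) ring_scheme \<Rightarrow> 'a \<Rightarrow> int" where
  "quad_char F x =
     (if x = \<zero>\<^bsub>F\<^esub> then 0 else if x \<in> nonzero_squares F then 1 else - 1)"

locale odd_field = field F for F (structure) +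
  assumes odd_order: "odd (order F)"
begin

abbreviation \<chi> :: "'a \<Rightarrow> int" where "\<chi> \<equiv> quad_char F"

lemma finite_carrier [simp]: "finite (carrier F)"
  using odd_order by (metis order_def card.infinite even_zero)

lemma order_ge_3: "order F \<ge> 3"
proof -
  have "card {\<zero>, \<one>} \<le> card (carrier F)"
    by (intro card_mono) auto
  then have "order F \<ge> 2" by (simp add: order_def)
  with odd_order show ?thesis by (cases "order F = 2") auto
qed

text \<open>The additive order of \<open>x\<close> divides both 2 and, by Lagrange, the odd order of
  the field.\<close>

lemma double_eq_zero:
  assumes x: "x \<in> carrier F" and "x \<oplus> x = \<zero>"
  shows "x = \<zero>"
proof -
  have "add.ord x dvd 2"
    using x assms(2) by (subst add.pow_eq_id[symmetric]) (auto simp: numeral_2_eq_2)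
  moreover have "add.ord x dvd order F"
    using add.ord_dvd_group_order[OF x] by (simp add: order_def)
  ultimately have "add.ord x dvd 1"
    using odd_order by (metis coprime_common_divisor coprime_left_2_iff_odd)
  then show ?thesis using add.ord_eq_1 x by simp
qed

lemma minus_one_neq_one: "\<ominus> \<one> \<noteq> \<one>"
  using double_eq_zero[of \<one>] by (metis l_neg one_closed zero_not_one)

text \<open>The multiplicative group is cyclic. Periodicity is recorded along with generation
  because it fixes exponents modulo the even number \<open>order F - 1\<close>, which gives them a
  well-defined parity.\<close>

lemma generator:
  obtains g where "g \<in> carrier F" "g \<noteq> \<zero>"
    "\<And>x. x \<in> carrier F \<Longrightarrow> x \<noteq> \<zero> \<Longrightarrow> \<exists>i::nat. x = g [^] i"
    "\<And>i::nat. g [^] i = \<one> \<longleftrightarrow> (order F - 1) dvd i"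
proof -
  interpret M: group "Multiplicative_Group.mult_of F" by (rule field_mult_group)
  obtain g where g: "g \<in> carrier (Multiplicative_Group.mult_of F)"
    and gen: "carrier (Multiplicative_Group.mult_of F) = {g[^]i | i::nat . i \<in> UNIV}"
    using finite_field_mult_group_has_gen[OF finite_carrier] by blast
  have "M.ord g = card (carrier (Multiplicative_Group.mult_of F))"
  proof -
    \<comment> \<open>For an element of positive order the natural powers already form the generated
      subgroup, whose size is the order of \<open>g\<close>.\<close>
    have "M.ord g \<noteq> 0" using M.ord_ge_1[OF _ g] by simp
    then have "carrier (Multiplicative_Group.mult_of F) = generate (Multiplicative_Group.mult_of F) {g}"
      using gen M.generate_pow_nat[OF g] by (simp add: Multiplicative_Group.nat_pow_mult_of)
    then show ?thesis using M.generate_pow_card[OF g] by simp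
  qed
  then have "M.ord g = order F - 1"
    by (simp add: order_def)
  with M.pow_eq_id[OF g] have "\<And>i::nat. g [^] i = \<one> \<longleftrightarrow> (order F - 1) dvd i"
    by (simp add: Multiplicative_Group.nat_pow_mult_of)
  moreover have "\<exists>i::nat. x = g [^] i" if "x \<in> carrier F" "x \<noteq> \<zero>" for x
  proof -
    have "x \<in> {g [^] i | i::nat. i \<in> UNIV}" unfolding gen[symmetric] using that by simp
    then show ?thesis by auto
  qed
  ultimately show thesis using g by (intro that[of g]) auto
qed

lemma nonzero_squares_subset: "nonzero_squares F \<subseteq> carrier F - {\<zero>}"
  by (auto simp: nonzero_squares_def numeral_2_eq_2 integral_iff)

lemma chi_zero [simp]: "\<chi> \<zero> = 0" by (simp add: quad_char_def)

text \<open>If a power of \<open>g\<close> is also the square of a power of \<open>g\<close>, the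
  two exponents agree modulo the even number \<open>order F - 1\<close>; hence the squares are
  exactly the even powers.\<close>

lemma chi_generator_pow:
  assumes g: "g \<in> carrier F" "g \<noteq> \<zero>"
    and gen: "\<And>x. x \<in> carrier F \<Longrightarrow> x \<noteq> \<zero> \<Longrightarrow> \<exists>i::nat. x = g [^] i"
    and ord: "\<And>i::nat. g [^] i = \<one> \<longleftrightarrow> (order F - 1) dvd i"
  shows "\<chi> (g [^] (i::nat)) = (- 1) ^ i"
proof -
  interpret M: group "Multiplicative_Group.mult_of F" by (rule field_mult_group)
  have nz: "g [^] k \<noteq> \<zero>" for k :: nat
    using M.nat_pow_closed[of g k] g by (simp add: Multiplicative_Group.nat_pow_mult_of)
  have "g [^] i \<in> nonzero_squares F \<longleftrightarrow> even i"
  proof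
    assume "even i"
    then obtain j where "i = j * 2" by (auto elim: evenE)
    then show "g [^] i \<in> nonzero_squares F"
      using g nz by (auto simp: nonzero_squares_def nat_pow_pow intro!: image_eqI[of _ _ "g [^] j"])
  next
    assume "g [^] i \<in> nonzero_squares F"
    then obtain x where "x \<in> carrier F" "x \<noteq> \<zero>" "g [^] i = x [^] (2::nat)"
      by (auto simp: nonzero_squares_def)
    with gen obtain j :: nat where j: "g [^] i = g [^] (j * 2)"
      using g by (metis nat_pow_pow)
    have "int (order F - 1) dvd int (j * 2) - int i"
    proof -
      have "M.ord g = order F - 1"
        using M.ord_unique g ord by (simp add: Multiplicative_Group.nat_pow_mult_of)
      moreover have "int (M.ord g) dvd int (j * 2) - int i"
        using M.int_pow_eq[of g "int i" "int (j * 2)"] g j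
        unfolding int_pow_int by (simp add: Multiplicative_Group.nat_pow_mult_of)
      ultimately show ?thesis by simp
    qed
    moreover have "even (int (order F - 1))" using odd_order by simp
    ultimately have "even (int (j * 2) - int i)" by (rule dvd_trans[rotated])
    then show "even i" by simp
  qed
  with nz show ?thesis by (simp add: quad_char_def)
qed

lemma chi_mult:
  assumes "x \<in> carrier F" "y \<in> carrier F"
  shows "\<chi> (x \<otimes> y) = \<chi> x * \<chi> y"
proof (cases "x = \<zero> \<or> y = \<zero>")
  case False
  obtain g where g: "g \<in> carrier F" "g \<noteq> \<zero>"
    "\<And>x. x \<in> carrier F \<Longrightarrow> x \<noteq> \<zero> \<Longrightarrow> \<exists>i::nat. x = g [^] i"
    "\<And>i::nat. g [^] i = \<one> \<longleftrightarrow> (order F - 1) dvd i"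
    using generator by blast
  then obtain i j :: nat where "x = g [^] i" "y = g [^] j"
    using False assms by metis
  then show ?thesis
    using chi_generator_pow[OF g] g(1) by (simp add: nat_pow_mult power_add)
qed (use assms in auto)

lemma chi_one [simp]: "\<chi> \<one> = 1"
proof -
  have "\<one> \<in> nonzero_squares F"
    by (auto simp: nonzero_squares_def intro!: image_eqI[of _ _ \<one>])
  then show ?thesis by (simp add: quad_char_def)
qed

text \<open>Write \<open>order F = 2 * k + 1\<close> and let \<open>i\<close> be the exponent of
  \<open>\<ominus> \<one>\<close>. Squaring gives \<open>k dvd i\<close>, and
  \<open>\<ominus> \<one> \<noteq> \<one>\<close> rules out even multiples of \<open>k\<close>, so
  \<open>i\<close> and \<open>k\<close> have the same parity.\<close>

lemma chi_minus_one: "\<chi> (\<ominus> \<one>) = (if order F mod 4 = 1 then 1 else - 1)"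
proof -
  obtain g where g: "g \<in> carrier F" "g \<noteq> \<zero>"
    "\<And>x. x \<in> carrier F \<Longrightarrow> x \<noteq> \<zero> \<Longrightarrow> \<exists>i::nat. x = g [^] i"
    "\<And>i::nat. g [^] i = \<one> \<longleftrightarrow> (order F - 1) dvd i"
    using generator by blast
  obtain i :: nat where i: "\<ominus> \<one> = g [^] i"
    using g(3)[of "\<ominus> \<one>"] by auto
  obtain k where k: "order F = 2 * k + 1" using odd_order by (elim oddE)
  have "g [^] (i * 2) = (\<ominus> \<one>) [^] (2::nat)" using i g by (simp add: nat_pow_pow)
  also have "\<dots> = \<one>" by (simp add: numeral_2_eq_2 l_minus)
  finally have "2 * k dvd i * 2" using g(4) k by simp
  then obtain m where m: "i = k * m" by auto
  have "\<not> 2 * k dvd i" using g(4)[of i] i minus_one_neq_one k by simp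
  then have "odd m" using m by auto
  then have "even i \<longleftrightarrow> even k" using m by simp
  also have "\<dots> \<longleftrightarrow> order F mod 4 = 1" unfolding k by presburger
  finally show ?thesis using chi_generator_pow[OF g, of i] i by simp
qed

lemma chi_minus:
  "x \<in> carrier F \<Longrightarrow> \<chi> (\<ominus> x) = \<chi> (\<ominus> \<one>) * \<chi> x"
  using chi_mult[of "\<ominus> \<one>" x] by (simp add: l_minus)

lemma chi_square:
  assumes "x \<in> carrier F" "x \<noteq> \<zero>"
  shows "\<chi> x * \<chi> x = 1"
  using assms by (simp add: quad_char_def)

section \<open>Character sums and correlations over one field\<close>

lemma sum_scale:
  assumes g: "g \<in> carrier F" "g \<noteq> \<zero>"
  shows "(\<Sum>x\<in>carrier F. f (g \<otimes> x)) = (\<Sum>x\<in>carrier F. f x)"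
proof -
  have "g \<in> Units F" using g field_Units by simp
  then show ?thesis
    by (intro sum.reindex_bij_witness[of _ "\<lambda>x. inv g \<otimes> x" "\<lambda>x. g \<otimes> x"])
       (use g in \<open>auto simp: m_assoc[symmetric]\<close>)
qed

text \<open>Multiplication by a generator permutes the field and flips the sign of the character, so
  the sum equals its own negative.\<close>

lemma sum_chi: "(\<Sum>x\<in>carrier F. \<chi> x) = 0"
proof -
  obtain g where g: "g \<in> carrier F" "g \<noteq> \<zero>"
    "\<And>x. x \<in> carrier F \<Longrightarrow> x \<noteq> \<zero> \<Longrightarrow> \<exists>i::nat. x = g [^] i"
    "\<And>i::nat. g [^] i = \<one> \<longleftrightarrow> (order F - 1) dvd i"
    using generator by blast
  have chi_g: "\<chi> g = - 1" using chi_generator_pow[OF g, of 1] g by simp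
  have "(\<Sum>x\<in>carrier F. \<chi> x) = (\<Sum>x\<in>carrier F. \<chi> (g \<otimes> x))"
    using sum_scale[OF g(1,2), of \<chi>] by simp
  also have "\<dots> = - (\<Sum>x\<in>carrier F. \<chi> x)"
    using g chi_g by (simp add: chi_mult sum_negf)
  finally show ?thesis by simp
qed

lemma sum_translate:
  assumes "a \<in> carrier F"
  shows "(\<Sum>x\<in>carrier F. f (x \<oplus> a)) = (\<Sum>x\<in>carrier F. f x)"
  by (rule sum.reindex_bij_witness[of _ "\<lambda>x. x \<ominus> a" "\<lambda>x. x \<oplus> a"])
     (use assms in \<open>auto simp: a_minus_def a_assoc l_neg r_neg\<close>)

text \<open>For nonzero \<open>x\<close> the summand equals \<open>\<chi> (1 + a / x)\<close>, and \<open>1 + a / x\<close> runs through all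
  elements except \<open>1\<close>.\<close>

lemma sum_chi_translate_mult:
  assumes a: "a \<in> carrier F"
  shows "(\<Sum>x\<in>carrier F. \<chi> (x \<oplus> a) * \<chi> x) = of_bool (a = \<zero>) * int (order F) - 1"
proof (cases "a = \<zero>")
  case True
  have "(\<Sum>x\<in>carrier F. \<chi> (x \<oplus> a) * \<chi> x) = (\<Sum>x\<in>carrier F - {\<zero>}. 1)"
    using True by (intro sum.mono_neutral_cong_right) (auto simp: chi_square)
  then show ?thesis using True order_ge_3 by (simp add: order_def)
next
  case False
  have "(\<Sum>x\<in>carrier F. \<chi> (x \<oplus> a) * \<chi> x) = (\<Sum>x\<in>carrier F - {\<zero>}. \<chi> (x \<oplus> a) * \<chi> x)"
    by (intro sum.mono_neutral_right) auto
  also have "\<dots> = (\<Sum>u\<in>carrier F - {\<zero>}. \<chi> (a \<otimes> u \<oplus> \<one>))"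
  proof (rule sum.reindex_bij_witness[of _ "\<lambda>u. inv u" "\<lambda>x. inv x"])
    fix x assume "x \<in> carrier F - {\<zero>}"
    then have x: "x \<in> carrier F" "x \<noteq> \<zero>" "inv x \<in> carrier F" "inv x \<otimes> x = \<one>"
      "inv x \<noteq> \<zero>" "inv (inv x) = x"
      using field_Units Units_inv_Units by auto
    then show "inv (inv x) = x" "inv x \<in> carrier F - {\<zero>}" "inv (inv x) = x"
      "inv x \<in> carrier F - {\<zero>}" by simp_all
    have "x \<oplus> a = (a \<otimes> inv x \<oplus> \<one>) \<otimes> x"
      using x a by (simp add: l_distr m_assoc a_comm)
    then have "\<chi> (x \<oplus> a) = \<chi> (a \<otimes> inv x \<oplus> \<one>) * \<chi> x"
      using x a chi_mult[of "a \<otimes> inv x \<oplus> \<one>" x] by simp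
    then show "\<chi> (a \<otimes> inv x \<oplus> \<one>) = \<chi> (x \<oplus> a) * \<chi> x"
      using chi_square[OF x(1,2)] by (simp add: mult.assoc)
  qed
  also have "\<dots> = (\<Sum>u\<in>carrier F. \<chi> (a \<otimes> u \<oplus> \<one>)) - 1"
    using a by (simp add: sum_diff1)
  also have "(\<Sum>u\<in>carrier F. \<chi> (a \<otimes> u \<oplus> \<one>)) = 0"
    using sum_scale[OF a False, of "\<lambda>u. \<chi> (u \<oplus> \<one>)"] sum_translate[of \<one> \<chi>] sum_chi by simp
  finally show ?thesis using False by simp
qed

lemma sum_delta_translate:
  fixes f :: "'a \<Rightarrow> int"
  assumes a: "a \<in> carrier F"
  shows "(\<Sum>x\<in>carrier F. of_bool (x \<oplus> a = \<zero>) * f x) = f (\<ominus> a)"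
proof -
  have "(\<Sum>x\<in>carrier F. of_bool (x \<oplus> a = \<zero>) * f x)
      = (\<Sum>x\<in>carrier F. if x = \<ominus> a then f x else 0)"
    using a by (intro sum.cong) (auto simp: l_neg minus_equality)
  also have "\<dots> = f (\<ominus> a)" using a by simp
  finally show ?thesis .
qed

lemma sum_delta:
  fixes f :: "'a \<Rightarrow> int"
  shows "(\<Sum>x\<in>carrier F. f x * of_bool (x = \<zero>)) = f \<zero>"
proof -
  have "(\<Sum>x\<in>carrier F. f x * of_bool (x = \<zero>)) = (\<Sum>x\<in>carrier F. if x = \<zero> then f x else 0)"
    by (intro sum.cong) auto
  also have "\<dots> = f \<zero>" by simp
  finally show ?thesis .
qed

text \<open>The parameter \<open>c\<close> stays general because the twin set needs
  \<open>c = 1\<close> over \<open>F\<close> and \<open>c = - 1\<close> over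
  \<open>K\<close>.\<close>

lemma sum_one_plus_delta:
  "(\<Sum>x\<in>carrier F. 1 + c * of_bool (x = \<zero>) :: int) = int (order F) + c"
  using sum_delta[of "\<lambda>_. c"] by (simp add: sum.distrib order_def)

lemma corr_one_plus_delta:
  assumes a: "a \<in> carrier F"
  shows "(\<Sum>x\<in>carrier F. (1 + c * of_bool (x \<oplus> a = \<zero>)) * (1 + c * of_bool (x = \<zero>)) :: int)
    = int (order F) + 2 * c + c * c * of_bool (a = \<zero>)"
proof -
  let ?f = "\<lambda>x. 1 + c * of_bool (x = \<zero>) :: int"
  have "(\<Sum>x\<in>carrier F. ?f (x \<oplus> a) * ?f x)
      = (\<Sum>x\<in>carrier F. ?f x) + c * (\<Sum>x\<in>carrier F. of_bool (x \<oplus> a = \<zero>) * ?f x)"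
    unfolding sum_distrib_left sum.distrib[symmetric]
    by (intro sum.cong) (simp_all add: algebra_simps)
  also have "\<dots> = int (order F) + c + c * ?f (\<ominus> a)"
    using sum_delta_translate[OF a, of ?f] by (simp add: sum_one_plus_delta)
  also have "\<ominus> a = \<zero> \<longleftrightarrow> a = \<zero>" using a by (metis minus_minus minus_zero)
  finally show ?thesis by (simp add: algebra_simps)
qed

text \<open>The constant part vanishes by \<open>sum_chi\<close>, and the delta picks out
  \<open>\<ominus> a\<close>. The other mixed correlation yields \<open>\<chi> a\<close> instead;
  this difference in sign of the argument is what later lets the mixed terms cancel.\<close>

lemma corr_one_plus_delta_chi:
  assumes a: "a \<in> carrier F"
  shows "(\<Sum>x\<in>carrier F. (1 + c * of_bool (x \<oplus> a = \<zero>)) * \<chi> x) = c * \<chi> (\<ominus> a)"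
proof -
  have "(\<Sum>x\<in>carrier F. (1 + c * of_bool (x \<oplus> a = \<zero>)) * \<chi> x)
      = (\<Sum>x\<in>carrier F. \<chi> x) + c * (\<Sum>x\<in>carrier F. of_bool (x \<oplus> a = \<zero>) * \<chi> x)"
    unfolding sum_distrib_left sum.distrib[symmetric]
    by (intro sum.cong) (simp_all add: algebra_simps)
  then show ?thesis using sum_delta_translate[OF a, of \<chi>] by (simp add: sum_chi)
qed

lemma corr_chi_one_plus_delta:
  assumes a: "a \<in> carrier F"
  shows "(\<Sum>x\<in>carrier F. \<chi> (x \<oplus> a) * (1 + c * of_bool (x = \<zero>))) = c * \<chi> a"
proof -
  have "(\<Sum>x\<in>carrier F. \<chi> (x \<oplus> a) * (1 + c * of_bool (x = \<zero>)))
      = (\<Sum>x\<in>carrier F. \<chi> (x \<oplus> a)) + c * (\<Sum>x\<in>carrier F. \<chi> (x \<oplus> a) * of_bool (x = \<zero>))"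
    unfolding sum_distrib_left sum.distrib[symmetric]
    by (intro sum.cong) (simp_all add: algebra_simps)
  then show ?thesis
    using sum_delta[of "\<lambda>x. \<chi> (x \<oplus> a)"] sum_translate[OF a, of \<chi>] a by (simp add: sum_chi)
qed

section \<open>Squares, or nonsquares, together with zero\<close>

text \<open>For \<open>e = 1\<close> these are the squares with zero, for \<open>e = - 1\<close> the
  nonsquares with zero. They are the sections of the twin set over nonzero second
  coordinates.\<close>

definition paley :: "int \<Rightarrow> 'a set" where
  "paley e = {x \<in> carrier F. x = \<zero> \<or> \<chi> x = e}"

lemma paley_subset: "paley e \<subseteq> carrier F"
  by (auto simp: paley_def)

lemma of_bool_paley:
  assumes "e \<in> {1, - 1}" "x \<in> carrier F"
  shows "2 * of_bool (x \<in> paley e) = 1 + of_bool (x = \<zero>) + e * \<chi> x"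
  using assms by (auto simp: paley_def quad_char_def)

lemma card_paley:
  assumes e: "e \<in> {1, - 1}"
  shows "2 * card (paley e) = order F + 1"
proof -
  have "int (2 * card (paley e)) = (\<Sum>x\<in>carrier F. 2 * of_bool (x \<in> paley e))"
    using paley_subset[of e] by (simp add: Int_absorb1 flip: sum_distrib_left)
  also have "\<dots> = (\<Sum>x\<in>carrier F. 1 + 1 * of_bool (x = \<zero>)) + e * (\<Sum>x\<in>carrier F. \<chi> x)"
    unfolding sum_distrib_left sum.distrib[symmetric]
    using e by (intro sum.cong) (simp_all only: of_bool_paley mult_1)
  also have "\<dots> = int (order F + 1)"
    unfolding sum_one_plus_delta sum_chi by simp
  finally show ?thesis by simp
qed

text \<open>Expanding the doubled indicators, the delta part contributes \<open>order F + 2\<close>,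
  the pure character part \<open>- 1\<close>, and the mixed part
  \<open>e * (\<chi> (\<ominus> a) + \<chi> a)\<close>, which vanishes because
  \<open>\<ominus> \<one>\<close> is a nonsquare.\<close>

lemma paley_autocorrelation:
  assumes e: "e \<in> {1, - 1}" and a: "a \<in> carrier F" "a \<noteq> \<zero>" and mod4: "order F mod 4 = 3"
  shows "4 * (\<Sum>x\<in>carrier F. of_bool (x \<oplus> a \<in> paley e) * of_bool (x \<in> paley e)) = int (order F) + 1"
proof -
  let ?u = "\<lambda>x. 1 + 1 * of_bool (x = \<zero>) :: int"
  have "4 * (\<Sum>x\<in>carrier F. of_bool (x \<oplus> a \<in> paley e) * of_bool (x \<in> paley e))
    = (\<Sum>x\<in>carrier F. (2 * of_bool (x \<oplus> a \<in> paley e)) * (2 * of_bool (x \<in> paley e)) :: int)"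
    unfolding sum_distrib_left by (intro sum.cong) simp_all
  also have "\<dots> = (\<Sum>x\<in>carrier F. (?u (x \<oplus> a) + e * \<chi> (x \<oplus> a)) * (?u x + e * \<chi> x))"
    using a by (intro sum.cong) (simp_all only: of_bool_paley[OF e] add.m_closed mult_1)
  also have "\<dots> = (\<Sum>x\<in>carrier F. ?u (x \<oplus> a) * ?u x) + e * (\<Sum>x\<in>carrier F. ?u (x \<oplus> a) * \<chi> x)
      + e * (\<Sum>x\<in>carrier F. \<chi> (x \<oplus> a) * ?u x) + e * e * (\<Sum>x\<in>carrier F. \<chi> (x \<oplus> a) * \<chi> x)"
    unfolding sum_distrib_left sum.distrib[symmetric]
    by (intro sum.cong) (simp_all add: algebra_simps)
  also have "\<dots> = int (order F) + 1 + e * (\<chi> (\<ominus> a) + \<chi> a)"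
    unfolding corr_one_plus_delta[OF a(1)] corr_one_plus_delta_chi[OF a(1)]
      corr_chi_one_plus_delta[OF a(1)] sum_chi_translate_mult[OF a(1)]
    using e a by (auto simp: algebra_simps)
  also have "\<chi> (\<ominus> a) + \<chi> a = 0"
    using chi_minus[OF a(1)] mod4 by (simp add: chi_minus_one)
  finally show ?thesis by simp
qed

lemma card_nonzero_squares: "2 * card (nonzero_squares F) + 1 = order F"
proof -
  have "paley 1 = insert \<zero> (nonzero_squares F)"
    using nonzero_squares_subset by (auto simp: paley_def quad_char_def)
  moreover have "\<zero> \<notin> nonzero_squares F" "finite (nonzero_squares F)"
    using nonzero_squares_subset finite_subset[OF nonzero_squares_subset] by auto
  ultimately show ?thesis using card_paley[of 1] by simp
qed

text \<open>If \<open>y \<noteq> z\<close> are nonzero squares and \<open>c = a / (y - z)\<close>, then \<open>c z\<close> and \<open>c z + a = c y\<close> lie in the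
  same quadratic class.\<close>

lemma order_eq_3_if_paley_translate:
  assumes a: "a \<in> carrier F"
    and translate: "\<And>x. x \<in> carrier F \<Longrightarrow> x \<oplus> a \<in> paley 1 \<longleftrightarrow> x \<in> paley (- 1)"
  shows "order F = 3"
proof (rule ccontr)
  assume "order F \<noteq> 3"
  \<comment> \<open>There are \<open>(order F - 1) / 2\<close> nonzero squares.\<close>
  then have "card (nonzero_squares F) \<ge> 2"
    using card_nonzero_squares order_ge_3 by linarith
  then obtain y z where yz: "y \<in> nonzero_squares F" "z \<in> nonzero_squares F" "y \<noteq> z"
    by (metis card_le_Suc0_iff_eq card.infinite not_less_eq_eq numeral_2_eq_2 zero_le)
  then have carr: "y \<in> carrier F" "z \<in> carrier F" and nz: "y \<noteq> \<zero>" "z \<noteq> \<zero>"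
    using nonzero_squares_subset by auto
  have "a \<noteq> \<zero>"
  proof
    assume "a = \<zero>"
    with translate[of \<one>] show False by (simp add: paley_def)
  qed
  have "y \<ominus> z \<noteq> \<zero>" using carr yz(3) by simp
  then have d: "y \<ominus> z \<in> Units F" using carr field_Units by simp
  define c where "c = a \<otimes> inv (y \<ominus> z)"
  have c: "c \<in> carrier F" using a d by (simp add: c_def)
  have cd: "c \<otimes> (y \<ominus> z) = a" using a d carr by (simp add: c_def m_assoc)
  then have "c \<noteq> \<zero>" using \<open>a \<noteq> \<zero>\<close> carr by auto
  have "c \<otimes> z \<oplus> a = c \<otimes> y"
  proof -
    have "c \<otimes> z \<oplus> c \<otimes> (y \<ominus> z) = c \<otimes> (z \<oplus> (y \<ominus> z))"
      using c carr by (simp add: r_distr)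
    also have "z \<oplus> (y \<ominus> z) = y"
      using carr by (simp add: a_minus_def a_lcomm r_neg)
    finally show ?thesis using cd by simp
  qed
  moreover have "\<chi> (c \<otimes> y) = \<chi> c" "\<chi> (c \<otimes> z) = \<chi> c"
    using c carr nz yz by (auto simp: chi_mult) (auto simp: quad_char_def)
  moreover have "\<chi> c = 1 \<or> \<chi> c = - 1" using \<open>c \<noteq> \<zero>\<close> by (simp add: quad_char_def)
  \<comment> \<open>In the class of squares \<open>c \<otimes> y\<close> lies in
    \<open>paley 1\<close> but \<open>c \<otimes> z\<close> is not in \<open>paley (- 1)\<close>; in
    the class of nonsquares it is the other way round. Either case violates
    \<open>translate\<close>.\<close>
  ultimately show False
    using translate[of "c \<otimes> z"] c carr nz \<open>c \<noteq> \<zero>\<close> by (auto simp: paley_def integral_iff)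
qed

end

section \<open>Counting differences and convolutions in finite groups\<close>

context group begin

text \<open>Sort the ordered pairs from \<open>D\<close> by their difference: the identity comes
  from the diagonal only, and every other element comes from \<open>l\<close> pairs.\<close>

lemma difference_set_card:
  assumes fin: "finite (carrier G)" and D: "difference_set G D"
  shows "\<exists>l::nat. card D * card D = card D + l * (order G - 1)"
proof -
  let ?fib = "\<lambda>g. {(x, y). x \<in> D \<and> y \<in> D \<and> x \<otimes> inv y = g}"
  from D obtain l where sub: "D \<subseteq> carrier G" and l: "\<And>g. g \<in> carrier G - {\<one>} \<Longrightarrow> card (?fib g) = l"
    by (auto simp: difference_set_def)
  have finD: "finite D" using sub fin finite_subset by blast
  have "card D * card D = (\<Sum>p\<in>D \<times> D. 1)" by (simp add: card_cartesian_product)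
  also have "\<dots> = (\<Sum>g\<in>carrier G. \<Sum>p\<in>{p \<in> D \<times> D. fst p \<otimes> inv (snd p) = g}. 1)"
    by (rule sum.group[symmetric]) (use sub fin finD in \<open>auto simp: subset_iff\<close>)
  also have "\<dots> = (\<Sum>g\<in>carrier G. card (?fib g))"
    by (intro sum.cong refl) (auto intro!: arg_cong[of _ _ card])
  also have "\<dots> = card (?fib \<one>) + (\<Sum>g\<in>carrier G - {\<one>}. card (?fib g))"
    using fin by (intro sum.remove) auto
  also have "(\<Sum>g\<in>carrier G - {\<one>}. card (?fib g)) = l * (order G - 1)"
    using l fin by (simp add: order_def)
  also have "?fib \<one> = (\<lambda>x. (x, x)) ` D"
  proof (intro equalityI subsetI)
    fix p assume "p \<in> ?fib \<one>"
    then obtain x y where p: "p = (x, y)" "x \<in> D" "y \<in> D" "x \<otimes> inv y = \<one>" by auto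
    then have "x = y" using sub by (metis inv_closed inv_equality inv_inv subsetD)
    with p show "p \<in> (\<lambda>x. (x, x)) ` D" by auto
  qed (use sub in auto)
  also have "card \<dots> = card D" by (simp add: card_image inj_on_def)
  finally show ?thesis by blast
qed

text \<open>Passes from complex-valued convolutions to cardinalities, where composite sets can be
  studied by counting.\<close>

lemma convolution_indicator:
  assumes "finite (carrier G)" "A \<subseteq> carrier G"
  shows "convolution G (indicator A) (indicator B) g = of_nat (card {a \<in> A. g \<otimes> inv a \<in> B})"
proof -
  have "convolution G (indicator A) (indicator B) g
      = (\<Sum>a\<in>carrier G. if a \<in> {a \<in> A. g \<otimes> inv a \<in> B} then 1 else 0)"
    unfolding convolution_def by (intro sum.cong) (auto simp: indicator_def)
  also have "\<dots> = of_nat (card (carrier G \<inter> {a \<in> A. g \<otimes> inv a \<in> B}))"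
    using assms(1) by (simp add: sum.If_cases)
  also have "carrier G \<inter> {a \<in> A. g \<otimes> inv a \<in> B} = {a \<in> A. g \<otimes> inv a \<in> B}"
    using assms(2) by auto
  finally show ?thesis .
qed

text \<open>After swapping the sums, each fixed \<open>a\<close> contributes the size of a translate
  of \<open>B\<close>.\<close>

lemma sum_card_convolution:
  assumes fin: "finite (carrier G)" and A: "A \<subseteq> carrier G" and B: "B \<subseteq> carrier G"
  shows "(\<Sum>g\<in>carrier G. card {a \<in> A. g \<otimes> inv a \<in> B}) = card A * card B"
proof -
  have "finite A" using fin A finite_subset by blast
  then have "(\<Sum>g\<in>carrier G. card {a \<in> A. g \<otimes> inv a \<in> B})
      = (\<Sum>g\<in>carrier G. \<Sum>a\<in>A. of_bool (g \<otimes> inv a \<in> B))"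
    by (simp add: Int_def)
  also have "\<dots> = (\<Sum>a\<in>A. \<Sum>g\<in>carrier G. of_bool (g \<otimes> inv a \<in> B))"
    by (rule sum.swap)
  also have "\<dots> = (\<Sum>a\<in>A. card B)"
  proof (intro sum.cong refl)
    fix a assume "a \<in> A"
    then have a: "a \<in> carrier G" using A by auto
    have "{g \<in> carrier G. g \<otimes> inv a \<in> B} = (\<lambda>b. b \<otimes> a) ` B"
    proof (intro equalityI subsetI)
      fix g assume "g \<in> {g \<in> carrier G. g \<otimes> inv a \<in> B}"
      then show "g \<in> (\<lambda>b. b \<otimes> a) ` B"
        using a by (auto intro!: image_eqI[of _ _ "g \<otimes> inv a"] simp: m_assoc)
    qed (use a B in \<open>auto simp: m_assoc subset_iff\<close>)
    moreover have "inj_on (\<lambda>b. b \<otimes> a) B" using a B by (auto simp: inj_on_def subset_iff)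
    ultimately show "(\<Sum>g\<in>carrier G. of_bool (g \<otimes> inv a \<in> B)) = card B"
      using fin by (simp add: Int_def card_image)
  qed
  finally show ?thesis by simp
qed

end

text \<open>A pair with difference \<open>g\<close> is determined by its second entry. This turns
  the count into an autocorrelation, to which the character sums apply.\<close>

lemma (in comm_group) card_differences:
  assumes fin: "finite (carrier G)" and D: "D \<subseteq> carrier G" and g: "g \<in> carrier G"
  shows "int (card {(x, y). x \<in> D \<and> y \<in> D \<and> x \<otimes> inv y = g})
    = (\<Sum>y\<in>carrier G. of_bool (y \<otimes> g \<in> D) * of_bool (y \<in> D))"
proof -
  have iff: "x \<otimes> inv y = g \<longleftrightarrow> x = y \<otimes> g" if "x \<in> D" "y \<in> D" for x y
    using that D g inv_solve_right[of g x y] by (auto simp: m_comm subset_iff)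
  have "{(x, y). x \<in> D \<and> y \<in> D \<and> x \<otimes> inv y = g}
      = (\<lambda>y. (y \<otimes> g, y)) ` {y \<in> carrier G. y \<otimes> g \<in> D \<and> y \<in> D}"
    (is "?L = ?R")
  proof (intro equalityI subsetI)
    fix p assume "p \<in> ?L"
    then obtain x y where "p = (x, y)" "x \<in> D" "y \<in> D" "x \<otimes> inv y = g" by auto
    with iff D show "p \<in> ?R" by (intro image_eqI[of _ _ y]) auto
  qed (use iff in auto)
  then have "card {(x, y). x \<in> D \<and> y \<in> D \<and> x \<otimes> inv y = g}
      = card {y \<in> carrier G. y \<otimes> g \<in> D \<and> y \<in> D}"
    by (simp add: card_image inj_on_def)
  then show ?thesis
    using fin by (simp add: Int_def flip: of_bool_conj)
qed

section \<open>The twin set and its autocorrelation\<close>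

locale twin_fields = F: odd_field F + K: odd_field K
  for F :: "('a, 'm) ring_scheme" (structure) and K :: "('b, 'n) ring_scheme" (structure) +
  assumes order_K: "order K = order F + 2"
begin

abbreviation Q :: nat where "Q \<equiv> order F"
abbreviation G :: "('a \<times> 'b) monoid" where "G \<equiv> twin_group F K"
abbreviation D :: "('a \<times> 'b) set" where "D \<equiv> twin_set F K"
abbreviation H :: "('a \<times> 'b) set" where "H \<equiv> carrier F \<times> {\<zero>\<^bsub>K\<^esub>}"

lemma carrier_G [simp]: "carrier G = carrier F \<times> carrier K"
  by (simp add: twin_group_def)

lemma one_G [simp]: "\<one>\<^bsub>G\<^esub> = (\<zero>\<^bsub>F\<^esub>, \<zero>\<^bsub>K\<^esub>)"
  by (simp add: twin_group_def)

lemma mult_G [simp]: "(a, b) \<otimes>\<^bsub>G\<^esub> (c, d) = (a \<oplus>\<^bsub>F\<^esub> c, b \<oplus>\<^bsub>K\<^esub> d)"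
  by (simp add: twin_group_def)

lemma inv_G [simp]:
  assumes "a \<in> carrier F" "b \<in> carrier K"
  shows "inv\<^bsub>G\<^esub> (a, b) = (\<ominus>\<^bsub>F\<^esub> a, \<ominus>\<^bsub>K\<^esub> b)"
  using assms by (simp add: twin_group_def F.add.is_group K.add.is_group a_inv_def)

sublocale G: comm_group G
proof -
  interpret group G
    unfolding twin_group_def by (intro DirProd_group F.add.is_group K.add.is_group)
  show "comm_group G"
    by (rule group_comm_groupI) (auto simp: F.a_comm K.a_comm)
qed

lemma order_G: "order G = Q * (Q + 2)"
  using order_K by (simp add: order_def card_cartesian_product)

text \<open>Over a nonzero \<open>y\<close> the first coordinate is zero or of the quadratic class
  opposite to that of \<open>y\<close>, hence the minus sign.\<close>

lemma mem_twin_set: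
  assumes "x \<in> carrier F" "y \<in> carrier K"
  shows "(x, y) \<in> D \<longleftrightarrow> y \<noteq> \<zero>\<^bsub>K\<^esub> \<and> x \<in> F.paley (- K.\<chi> y)"
  using assms F.nonzero_squares_subset K.nonzero_squares_subset
  by (auto simp: twin_set_def F.paley_def quad_char_def nonsquares_def)

lemma twin_set_subset: "D \<subseteq> carrier G"
  using F.nonzero_squares_subset K.nonzero_squares_subset
  by (auto simp: twin_set_def nonsquares_def)

lemma twin_set_eq_complement: "D = carrier G - classical_twin_set F K"
  using F.nonzero_squares_subset K.nonzero_squares_subset
  by (auto simp: twin_set_def classical_twin_set_def nonsquares_def)

text \<open>The coefficients \<open>1\<close> and \<open>- 1\<close> are written out so that both
  factors match the \<open>1 + c * of_bool\<close> pattern of the one-field sums.\<close>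

lemma of_bool_twin_set:
  assumes "x \<in> carrier F" "y \<in> carrier K"
  shows "2 * of_bool ((x, y) \<in> D) =
    (1 + 1 * of_bool (x = \<zero>\<^bsub>F\<^esub>)) * (1 + (- 1) * of_bool (y = \<zero>\<^bsub>K\<^esub>)) - F.\<chi> x * K.\<chi> y"
  using assms by (auto simp: mem_twin_set F.paley_def quad_char_def)

text \<open>The two odd orders differ by 2, so exactly one of them is 1 modulo 4.\<close>

lemma chi_psi_minus:
  assumes "a \<in> carrier F" "b \<in> carrier K"
  shows "F.\<chi> (\<ominus>\<^bsub>F\<^esub> a) * K.\<chi> (\<ominus>\<^bsub>K\<^esub> b) = - (F.\<chi> a * K.\<chi> b)"
proof -
  have "F.\<chi> (\<ominus>\<^bsub>F\<^esub> \<one>\<^bsub>F\<^esub>) * K.\<chi> (\<ominus>\<^bsub>K\<^esub> \<one>\<^bsub>K\<^esub>) = - 1"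
  proof -
    have "(Q mod 4 = 1) \<noteq> ((Q + 2) mod 4 = 1)" using F.odd_order by presburger
    then show ?thesis by (auto simp: F.chi_minus_one K.chi_minus_one order_K)
  qed
  then show ?thesis
    using F.chi_minus[OF assms(1)] K.chi_minus[OF assms(2)] by (simp add: algebra_simps)
qed

text \<open>The character part sums to zero, and the other part gives \<open>Q + 1\<close> over
  \<open>F\<close> times \<open>(Q + 2) - 1\<close> over \<open>K\<close>.\<close>

lemma card_twin_set: "2 * card D = (Q + 1)\<^sup>2"
proof -
  let ?u = "\<lambda>x. 1 + 1 * of_bool (x = \<zero>\<^bsub>F\<^esub>) :: int"
  let ?v = "\<lambda>y. 1 + (- 1) * of_bool (y = \<zero>\<^bsub>K\<^esub>) :: int"
  have "int (2 * card D) = (\<Sum>p\<in>carrier G. 2 * of_bool (p \<in> D))"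
    using twin_set_subset by (simp add: Int_absorb1 flip: sum_distrib_left)
  also have "\<dots> = (\<Sum>x\<in>carrier F. \<Sum>y\<in>carrier K. ?u x * ?v y - F.\<chi> x * K.\<chi> y)"
    unfolding carrier_G sum.cartesian_product
    by (intro sum.cong refl) (clarsimp simp only: of_bool_twin_set)
  also have "\<dots> = (\<Sum>x\<in>carrier F. ?u x) * (\<Sum>y\<in>carrier K. ?v y)
      - (\<Sum>x\<in>carrier F. F.\<chi> x) * (\<Sum>y\<in>carrier K. K.\<chi> y)"
    unfolding sum_subtractf sum_product ..
  also have "\<dots> = int ((Q + 1)\<^sup>2)"
    unfolding F.sum_one_plus_delta K.sum_one_plus_delta F.sum_chi K.sum_chi
    by (simp add: order_K power2_eq_square algebra_simps)
  finally show ?thesis by (simp only: of_nat_eq_iff)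
qed

lemma twin_set_autocorrelation:
  assumes a: "a \<in> carrier F" and b: "b \<in> carrier K" and nz: "(a, b) \<noteq> (\<zero>\<^bsub>F\<^esub>, \<zero>\<^bsub>K\<^esub>)"
  shows "4 * (\<Sum>p\<in>carrier G. of_bool (p \<otimes>\<^bsub>G\<^esub> (a, b) \<in> D) * of_bool (p \<in> D)) = (int Q + 1)\<^sup>2"
proof -
  let ?u = "\<lambda>x. 1 + 1 * of_bool (x = \<zero>\<^bsub>F\<^esub>) :: int"
  let ?v = "\<lambda>y. 1 + (- 1) * of_bool (y = \<zero>\<^bsub>K\<^esub>) :: int"
  have "4 * (\<Sum>p\<in>carrier G. of_bool (p \<otimes>\<^bsub>G\<^esub> (a, b) \<in> D) * of_bool (p \<in> D))
      = (\<Sum>p\<in>carrier G. (2 * of_bool (p \<otimes>\<^bsub>G\<^esub> (a, b) \<in> D)) * (2 * of_bool (p \<in> D)) :: int)"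
    unfolding sum_distrib_left by (intro sum.cong) simp_all
  also have "\<dots> = (\<Sum>x\<in>carrier F. \<Sum>y\<in>carrier K.
      (?u (x \<oplus>\<^bsub>F\<^esub> a) * ?v (y \<oplus>\<^bsub>K\<^esub> b) - F.\<chi> (x \<oplus>\<^bsub>F\<^esub> a) * K.\<chi> (y \<oplus>\<^bsub>K\<^esub> b)) * (?u x * ?v y - F.\<chi> x * K.\<chi> y))"
    unfolding carrier_G sum.cartesian_product using a b
    by (intro sum.cong refl)
       (clarsimp simp only: of_bool_twin_set mult_G F.add.m_closed K.add.m_closed)
  also have "\<dots> = (\<Sum>x\<in>carrier F. \<Sum>y\<in>carrier K.
        (?u (x \<oplus>\<^bsub>F\<^esub> a) * ?u x) * (?v (y \<oplus>\<^bsub>K\<^esub> b) * ?v y)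
      - (?u (x \<oplus>\<^bsub>F\<^esub> a) * F.\<chi> x) * (?v (y \<oplus>\<^bsub>K\<^esub> b) * K.\<chi> y)
      - (F.\<chi> (x \<oplus>\<^bsub>F\<^esub> a) * ?u x) * (K.\<chi> (y \<oplus>\<^bsub>K\<^esub> b) * ?v y)
      + (F.\<chi> (x \<oplus>\<^bsub>F\<^esub> a) * F.\<chi> x) * (K.\<chi> (y \<oplus>\<^bsub>K\<^esub> b) * K.\<chi> y))"
    by (intro sum.cong refl) (simp only: algebra_simps)
  also have "\<dots> =
        (\<Sum>x\<in>carrier F. ?u (x \<oplus>\<^bsub>F\<^esub> a) * ?u x) * (\<Sum>y\<in>carrier K. ?v (y \<oplus>\<^bsub>K\<^esub> b) * ?v y)
      - (\<Sum>x\<in>carrier F. ?u (x \<oplus>\<^bsub>F\<^esub> a) * F.\<chi> x) * (\<Sum>y\<in>carrier K. ?v (y \<oplus>\<^bsub>K\<^esub> b) * K.\<chi> y)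
      - (\<Sum>x\<in>carrier F. F.\<chi> (x \<oplus>\<^bsub>F\<^esub> a) * ?u x) * (\<Sum>y\<in>carrier K. K.\<chi> (y \<oplus>\<^bsub>K\<^esub> b) * ?v y)
      + (\<Sum>x\<in>carrier F. F.\<chi> (x \<oplus>\<^bsub>F\<^esub> a) * F.\<chi> x) * (\<Sum>y\<in>carrier K. K.\<chi> (y \<oplus>\<^bsub>K\<^esub> b) * K.\<chi> y)"
    unfolding sum.distrib sum_subtractf sum_product ..
  \<comment> \<open>The first and last products add up to \<open>(Q + 1)\<^sup>2\<close> in each of
    the three cases: \<open>Q * (Q + 2) + 1\<close> if \<open>a\<close> and \<open>b\<close> are
    nonzero, \<open>Q * (Q + 3) - (Q - 1)\<close> if only \<open>a\<close> is zero, and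
    \<open>(Q + 2) * (Q + 1) - (Q + 1)\<close> if only \<open>b\<close> is zero. The mixed terms
    turn positive because \<open>c = - 1\<close> over \<open>K\<close>.\<close>
  also have "\<dots> = (int Q + 1)\<^sup>2 + F.\<chi> (\<ominus>\<^bsub>F\<^esub> a) * K.\<chi> (\<ominus>\<^bsub>K\<^esub> b) + F.\<chi> a * K.\<chi> b"
    unfolding F.corr_one_plus_delta[OF a] F.corr_one_plus_delta_chi[OF a]
      F.corr_chi_one_plus_delta[OF a] F.sum_chi_translate_mult[OF a]
      K.corr_one_plus_delta[OF b] K.corr_one_plus_delta_chi[OF b]
      K.corr_chi_one_plus_delta[OF b] K.sum_chi_translate_mult[OF b]
    using nz by (auto simp: order_K power2_eq_square algebra_simps)
  also have "\<dots> = (int Q + 1)\<^sup>2" using chi_psi_minus[OF a b] by simp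
  finally show ?thesis .
qed

lemma difference_set_twin_set: "difference_set G D"
  unfolding difference_set_def
proof (intro conjI twin_set_subset exI ballI)
  fix g assume g: "g \<in> carrier G - {\<one>\<^bsub>G\<^esub>}"
  have "4 * int (card {(x, y). x \<in> D \<and> y \<in> D \<and> x \<otimes>\<^bsub>G\<^esub> inv\<^bsub>G\<^esub> y = g}) = (int Q + 1)\<^sup>2"
    using G.card_differences[OF _ twin_set_subset, of g] g
      twin_set_autocorrelation[of "fst g" "snd g"] by (auto simp: prod_eq_iff)
  \<comment> \<open>The division is exact, since four times the count is
    \<open>(Q + 1)\<^sup>2\<close>.\<close>
  then show "card {(x, y). x \<in> D \<and> y \<in> D \<and> x \<otimes>\<^bsub>G\<^esub> inv\<^bsub>G\<^esub> y = g} = nat ((int Q + 1)\<^sup>2 div 4)"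
    by linarith
qed

section \<open>Fineness and the uniqueness of the subgroup\<close>

text \<open>With \<open>s = (Q + 1)\<^sup>2\<close> the group has \<open>s - 1\<close> elements and
  the twin set \<open>s / 2\<close>, and the radicand simplifies to \<open>s\<close>.\<close>

lemma fine_parameter_twin: "fine_parameter G D = real Q + 1"
proof -
  define q where "q = real Q"
  have q: "q \<ge> 3" using F.order_ge_3 by (simp add: q_def)
  have card: "real (card D) = (q + 1)\<^sup>2 / 2"
    using arg_cong[OF card_twin_set, of real] by (simp add: q_def add_ac mult_ac)
  have ord: "real (order G) = (q + 1)\<^sup>2 - 1"
    by (simp add: order_G q_def power2_eq_square algebra_simps)
  \<comment> \<open>This bound keeps the denominator \<open>s - 1 - s / 2\<close> away from
    zero.\<close>
  have sq: "(q + 1)\<^sup>2 \<ge> 16" using power_mono[of 4 "q + 1" 2] q by simp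
  define s where "s = (q + 1)\<^sup>2"
  have "s - 2 > 0" using sq by (simp add: s_def)
  then have "s / 2 * (s - 1 - 1) / (s - 1 - s / 2) = s"
    by (simp add: divide_simps)
  then show ?thesis
    unfolding fine_parameter_def card ord s_def[symmetric]
    using q by (simp add: s_def q_def)
qed

lemma order_div_fine_parameter: "real (order G) / (fine_parameter G D + 1) = real Q"
  by (simp add: fine_parameter_twin order_G field_simps)

lemma subgroup_H: "subgroup H G"
proof (rule G.subgroupI)
qed (auto simp: twin_group_def intro: K.add.inv_one)

text \<open>By Lagrange in \<open>H'\<close> and in \<open>K\<close>, the additive order of the
  second coordinate divides \<open>Q\<close> and \<open>Q + 2\<close>. As \<open>Q\<close> is odd,
  that coordinate is zero, and equal cardinalities finish.\<close>

lemma subgroup_of_order_Q: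
  assumes sub: "subgroup H' G" and card: "card H' = Q"
  shows "H' = H"
proof (rule card_subset_eq)
  show "finite H" by simp
  show "card H' = card H" using card by (simp add: order_def card_cartesian_product)
  show "H' \<subseteq> H"
  proof
    fix h assume h: "h \<in> H'"
    interpret H': group "G\<lparr>carrier := H'\<rparr>"
      using sub G.subgroup_imp_group by blast
    have hG: "h \<in> carrier G" using h sub subgroup.subset by blast
    have "h [^]\<^bsub>G\<^esub> Q = \<one>\<^bsub>G\<^esub>"
      using H'.pow_order_eq_1[of h] h card by (simp add: order_def nat_pow_def)
    moreover have "snd (h [^]\<^bsub>G\<^esub> n) = snd h [^]\<^bsub>add_monoid K\<^esub> n" for n :: nat
      by (induction n) (simp_all add: twin_group_def mult_DirProd')
    ultimately have "snd h [^]\<^bsub>add_monoid K\<^esub> Q = \<zero>\<^bsub>K\<^esub>" by (metis one_G snd_conv)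
    then have "K.add.ord (snd h) dvd Q"
      using K.add.pow_eq_id[of "snd h" Q] hG by (auto simp: add_pow_def)
    moreover have "K.add.ord (snd h) dvd Q + 2"
      using K.add.ord_dvd_group_order[of "snd h"] hG order_K by (auto simp: order_def)
    ultimately have "K.add.ord (snd h) dvd 2" by (metis dvd_add_right_iff)
    with \<open>K.add.ord (snd h) dvd Q\<close> have "K.add.ord (snd h) dvd 1"
      using F.odd_order by (metis coprime_common_divisor coprime_left_2_iff_odd)
    then have "snd h = \<zero>\<^bsub>K\<^esub>" using K.add.ord_eq_1[of "snd h"] hG by auto
    then show "h \<in> H" using hG by auto
  qed
qed

text \<open>Removes the existential quantifier over subgroups from \<open>fine\<close>,
  \<open>amalgam\<close> and \<open>composite\<close>.\<close>

lemma fine_wrt_twin_iff: "fine_wrt G H' D \<longleftrightarrow> H' = H"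
proof
  assume "fine_wrt G H' D"
  then show "H' = H"
    using subgroup_of_order_Q unfolding fine_wrt_def order_div_fine_parameter by simp
next
  assume "H' = H"
  moreover have "D \<noteq> {}" using card_twin_set by auto
  moreover have "D \<inter> H = {}" by (auto simp: mem_twin_set)
  moreover have "card H = Q" by (simp add: order_def card_cartesian_product)
  ultimately show "fine_wrt G H' D"
    unfolding fine_wrt_def order_div_fine_parameter
    using difference_set_twin_set subgroup_H by simp
qed

section \<open>Intersections of \<open>H\<close> with translates, and the amalgam criterion\<close>

lemma fiber_eq:
  assumes a: "a \<in> carrier F" and b: "b \<in> carrier K"
  shows "H \<inter> (D #>\<^bsub>G\<^esub> inv\<^bsub>G\<^esub> (a, b)) =
    (if b = \<zero>\<^bsub>K\<^esub> then {} else {x \<in> carrier F. x \<oplus>\<^bsub>F\<^esub> a \<in> F.paley (- K.\<chi> b)} \<times> {\<zero>\<^bsub>K\<^esub>})"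
proof -
  have "(x, \<zero>\<^bsub>K\<^esub>) \<in> D #>\<^bsub>G\<^esub> inv\<^bsub>G\<^esub> (a, b) \<longleftrightarrow> (x \<oplus>\<^bsub>F\<^esub> a, b) \<in> D" if x: "x \<in> carrier F" for x
  proof
    assume "(x, \<zero>\<^bsub>K\<^esub>) \<in> D #>\<^bsub>G\<^esub> inv\<^bsub>G\<^esub> (a, b)"
    then obtain d where d: "d \<in> D" "(x, \<zero>\<^bsub>K\<^esub>) = d \<otimes>\<^bsub>G\<^esub> inv\<^bsub>G\<^esub> (a, b)"
      unfolding r_coset_def by blast
    have dG: "d \<in> carrier G" using d(1) twin_set_subset by blast
    have "d = (x, \<zero>\<^bsub>K\<^esub>) \<otimes>\<^bsub>G\<^esub> (a, b)"
    proof -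
      have "(a, b) \<in> carrier G" using a b by simp
      then show ?thesis
        unfolding d(2) using dG by (simp add: G.m_assoc del: inv_G mult_G one_G carrier_G)
    qed
    with d(1) b show "(x \<oplus>\<^bsub>F\<^esub> a, b) \<in> D" by simp
  next
    assume "(x \<oplus>\<^bsub>F\<^esub> a, b) \<in> D"
    moreover have "(x, \<zero>\<^bsub>K\<^esub>) = (x \<oplus>\<^bsub>F\<^esub> a, b) \<otimes>\<^bsub>G\<^esub> inv\<^bsub>G\<^esub> (a, b)"
      using a b x by (simp add: F.a_assoc F.r_neg K.r_neg)
    ultimately show "(x, \<zero>\<^bsub>K\<^esub>) \<in> D #>\<^bsub>G\<^esub> inv\<^bsub>G\<^esub> (a, b)"
      by (auto simp: r_coset_def)
  qed
  then show ?thesis using a b by (auto simp: mem_twin_set)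
qed

lemma amalgam_twin_iff: "amalgam G D \<longleftrightarrow> Q mod 4 = 3"
proof -
  interpret H: comm_group "G\<lparr>carrier := H\<rparr>"
  proof -
    interpret group "G\<lparr>carrier := H\<rparr>"
      using subgroup_H G.subgroup_imp_group by blast
    show "comm_group (G\<lparr>carrier := H\<rparr>)"
      by (rule group_comm_groupI) (auto simp: F.a_comm)
  qed
  have "amalgam G D \<longleftrightarrow> (\<forall>a\<in>carrier F. \<forall>b\<in>carrier K.
      difference_set (G\<lparr>carrier := H\<rparr>) (H \<inter> (D #>\<^bsub>G\<^esub> inv\<^bsub>G\<^esub> (a, b))))"
    by (simp add: amalgam_def fine_wrt_twin_iff)
  also have "\<dots> \<longleftrightarrow> Q mod 4 = 3"
  proof (intro iffI ballI)
    assume *: "\<forall>a\<in>carrier F. \<forall>b\<in>carrier K.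
      difference_set (G\<lparr>carrier := H\<rparr>) (H \<inter> (D #>\<^bsub>G\<^esub> inv\<^bsub>G\<^esub> (a, b)))"
    define P where "P = F.paley (- 1) \<times> {\<zero>\<^bsub>K\<^esub>}"
    \<comment> \<open>Since \<open>\<one>\<close> is a square in \<open>K\<close>, the fiber over it
      consists of the nonsquares of \<open>F\<close> and zero.\<close>
    have "H \<inter> (D #>\<^bsub>G\<^esub> inv\<^bsub>G\<^esub> (\<zero>\<^bsub>F\<^esub>, \<one>\<^bsub>K\<^esub>)) = P"
      by (subst fiber_eq) (auto simp: P_def F.paley_def)
    with * have "difference_set (G\<lparr>carrier := H\<rparr>) P"
      by (metis F.zero_closed K.one_closed)
    then obtain l where l: "card P * card P = card P + l * (Q - 1)"
      using H.difference_set_card[of P]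
      by (auto simp: order_def card_cartesian_product)
    obtain k where k: "Q = 2 * k + 1" "k > 0"
      using F.odd_order F.order_ge_3 by (elim oddE) auto
    have "card P = k + 1"
      using F.card_paley[of "- 1"] k by (simp add: P_def card_cartesian_product)
    \<comment> \<open>A difference set of \<open>k + 1\<close> elements in a group of order
      \<open>2 * k + 1\<close> needs \<open>k * (k + 1) = 2 * k * l\<close>, so \<open>k\<close> is
      odd.\<close>
    with l k have "(k + 1) * (k + 1) = (k + 1) + l * (2 * k)" by simp
    then have "k * (k + 1) = k * (2 * l)" by (simp add: algebra_simps)
    then have "k + 1 = 2 * l" using \<open>k > 0\<close> by (simp only: mult_cancel1) simp
    then show "Q mod 4 = 3" using k by presburger
  next
    fix a b
    assume mod4: "Q mod 4 = 3" and a: "a \<in> carrier F" and b: "b \<in> carrier K"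
    show "difference_set (G\<lparr>carrier := H\<rparr>) (H \<inter> (D #>\<^bsub>G\<^esub> inv\<^bsub>G\<^esub> (a, b)))"
    proof (cases "b = \<zero>\<^bsub>K\<^esub>")
      case True
      then show ?thesis using fiber_eq[OF a b] by (simp add: difference_set_def)
    next
      case False
      define e where "e = - K.\<chi> b"
      have e: "e \<in> {1, - 1}" using False by (auto simp: e_def quad_char_def)
      define T where "T = {x \<in> carrier F. x \<oplus>\<^bsub>F\<^esub> a \<in> F.paley e} \<times> {\<zero>\<^bsub>K\<^esub>}"
      have T: "T \<subseteq> H" by (auto simp: T_def)
      have "difference_set (G\<lparr>carrier := H\<rparr>) T"
        unfolding difference_set_def
      proof (intro conjI exI ballI)
        fix g assume g: "g \<in> carrier (G\<lparr>carrier := H\<rparr>) - {\<one>\<^bsub>G\<lparr>carrier := H\<rparr>\<^esub>}"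
        then obtain c where c: "g = (c, \<zero>\<^bsub>K\<^esub>)" "c \<in> carrier F" "c \<noteq> \<zero>\<^bsub>F\<^esub>" by auto
        let ?n = "card {(x, y). x \<in> T \<and> y \<in> T \<and>
          x \<otimes>\<^bsub>G\<lparr>carrier := H\<rparr>\<^esub> inv\<^bsub>G\<lparr>carrier := H\<rparr>\<^esub> y = g}"
        let ?f = "\<lambda>x. of_bool (x \<oplus>\<^bsub>F\<^esub> c \<in> F.paley e) * of_bool (x \<in> F.paley e) :: int"
        have "int ?n = (\<Sum>p\<in>H. of_bool (p \<otimes>\<^bsub>G\<^esub> g \<in> T) * of_bool (p \<in> T))"
          using H.card_differences[of T g] T g by simp
        \<comment> \<open>Dropping the zero second coordinate leaves a sum over \<open>F\<close>;
          the shift by \<open>a\<close> is then absorbed, as autocorrelation is translation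
          invariant.\<close>
        also have "\<dots> = (\<Sum>x\<in>carrier F. ?f (x \<oplus>\<^bsub>F\<^esub> a))"
          by (rule sum.reindex_bij_witness[of _ "\<lambda>x. (x, \<zero>\<^bsub>K\<^esub>)" fst])
             (use c a in \<open>auto simp: T_def F.add.m_ac\<close>)
        also have "\<dots> = (\<Sum>x\<in>carrier F. ?f x)" by (rule F.sum_translate[OF a])
        finally have "4 * int ?n = int Q + 1"
          using F.paley_autocorrelation[OF e c(2,3) mod4] by simp
        then show "?n = (Q + 1) div 4" by linarith
      qed (use T in simp)
      then show ?thesis using fiber_eq[OF a b] False by (simp add: T_def e_def)
    qed
  qed
  finally show ?thesis .
qed

section \<open>Composite twin sets\<close>

lemma composite_twin:
  assumes "composite G D"
  shows "Q = 3"
proof -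
  obtain A B where A: "A \<subseteq> carrier G" "real (card A) = real Q + 1"
    and B: "difference_set (G\<lparr>carrier := H\<rparr>) B"
    and conv: "\<And>g. g \<in> carrier G \<Longrightarrow>
      indicator D g = convolution G (indicator A) (indicator B) g"
    using assms unfolding composite_def fine_wrt_twin_iff fine_parameter_twin by blast
  have BH: "B \<subseteq> H" using B by (simp add: difference_set_def)
  then have BG: "B \<subseteq> carrier G" by auto
  have "finite (carrier G)" by simp
  \<comment> \<open>Each element of the twin set has exactly one representation through
    \<open>A\<close> and \<open>B\<close>, and every other element has none.\<close>
  have conv': "of_bool (g \<in> D) = card {a \<in> A. g \<otimes>\<^bsub>G\<^esub> inv\<^bsub>G\<^esub> a \<in> B}" if "g \<in> carrier G" for g
  proof -
    have "(of_nat (card {a \<in> A. g \<otimes>\<^bsub>G\<^esub> inv\<^bsub>G\<^esub> a \<in> B}) :: complex) = of_nat (of_bool (g \<in> D))"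
      using conv[OF that] G.convolution_indicator[OF \<open>finite (carrier G)\<close> A(1)]
      by (simp add: indicator_def)
    then show ?thesis by (simp only: of_nat_eq_iff)
  qed
  have "card D = (\<Sum>g\<in>carrier G. of_bool (g \<in> D))"
    using twin_set_subset by (simp add: Int_absorb1)
  also have "\<dots> = card A * card B"
    unfolding G.sum_card_convolution[OF \<open>finite (carrier G)\<close> A(1) BG, symmetric]
    by (intro sum.cong refl conv')
  also have "card A = Q + 1" using A(2) by linarith
  finally have "card D = (Q + 1) * card B" .
  then have "(Q + 1) * (2 * card B) = (Q + 1) * (Q + 1)"
    using card_twin_set by (simp add: power2_eq_square)
  then have card_B: "2 * card B = Q + 1" by (simp only: mult_cancel1) simp
  \<comment> \<open>A representation of \<open>(0, y)\<close> uses some \<open>(t, z)\<close> in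
    \<open>A\<close>, and \<open>B \<subseteq> H\<close> forces \<open>z = y\<close>. The
    corresponding translate of \<open>B\<close> lies inside the section over \<open>y\<close>; both
    have \<open>(Q + 1) / 2\<close> elements, so they coincide.\<close>
  have translate: "\<exists>t\<in>carrier F. (\<lambda>b. b \<oplus>\<^bsub>F\<^esub> t) ` fst ` B = F.paley (- K.\<chi> y)"
    if y: "y \<in> carrier K" "y \<noteq> \<zero>\<^bsub>K\<^esub>" for y
  proof -
    have "(\<zero>\<^bsub>F\<^esub>, y) \<in> D" using y by (simp add: mem_twin_set F.paley_def)
    with conv'[of "(\<zero>\<^bsub>F\<^esub>, y)"] y
    have "card {a \<in> A. (\<zero>\<^bsub>F\<^esub>, y) \<otimes>\<^bsub>G\<^esub> inv\<^bsub>G\<^esub> a \<in> B} = 1" by simp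
    then have "{a \<in> A. (\<zero>\<^bsub>F\<^esub>, y) \<otimes>\<^bsub>G\<^esub> inv\<^bsub>G\<^esub> a \<in> B} \<noteq> {}" by (metis card.empty zero_neq_one)
    then obtain t z where tz: "(t, z) \<in> A" "(\<zero>\<^bsub>F\<^esub>, y) \<otimes>\<^bsub>G\<^esub> inv\<^bsub>G\<^esub> (t, z) \<in> B" by auto
    have t: "t \<in> carrier F" and z: "z \<in> carrier K" using tz A(1) by auto
    have "y \<ominus>\<^bsub>K\<^esub> z = \<zero>\<^bsub>K\<^esub>" using tz(2) t z BH by (auto simp: a_minus_def)
    then have [simp]: "z = y" using y z by simp
    have sub: "(\<lambda>b. b \<oplus>\<^bsub>F\<^esub> t) ` fst ` B \<subseteq> F.paley (- K.\<chi> y)"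
    proof clarsimp
      fix b b' assume b: "(b, b') \<in> B"
      then have bF: "b \<in> carrier F" and [simp]: "b' = \<zero>\<^bsub>K\<^esub>" using BH by auto
      have "(b \<oplus>\<^bsub>F\<^esub> t, y) \<otimes>\<^bsub>G\<^esub> inv\<^bsub>G\<^esub> (t, y) = (b, b')"
        using t y bF by (simp add: F.a_assoc F.r_neg K.r_neg)
      then have "(t, y) \<in> {a \<in> A. (b \<oplus>\<^bsub>F\<^esub> t, y) \<otimes>\<^bsub>G\<^esub> inv\<^bsub>G\<^esub> a \<in> B}"
        using tz b by simp
      moreover have "finite A" using A(1) finite_subset[OF A(1)] by simp
      ultimately have "card {a \<in> A. (b \<oplus>\<^bsub>F\<^esub> t, y) \<otimes>\<^bsub>G\<^esub> inv\<^bsub>G\<^esub> a \<in> B} \<noteq> 0" by auto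
      then have "(b \<oplus>\<^bsub>F\<^esub> t, y) \<in> D"
        using conv'[of "(b \<oplus>\<^bsub>F\<^esub> t, y)"] bF t y by (auto simp: of_bool_def split: if_splits)
      then show "b \<oplus>\<^bsub>F\<^esub> t \<in> F.paley (- K.\<chi> y)" using mem_twin_set bF t y by simp
    qed
    have "inj_on (\<lambda>b. b \<oplus>\<^bsub>F\<^esub> t) (fst ` B)" "inj_on fst B"
      using BH t by (auto simp: inj_on_def subset_iff)
    then have "card ((\<lambda>b. b \<oplus>\<^bsub>F\<^esub> t) ` fst ` B) = card B" by (simp add: card_image)
    moreover have "- K.\<chi> y \<in> {1, - 1}" using y by (auto simp: quad_char_def)
    ultimately have "card ((\<lambda>b. b \<oplus>\<^bsub>F\<^esub> t) ` fst ` B) = card (F.paley (- K.\<chi> y))"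
      using F.card_paley[of "- K.\<chi> y"] card_B by simp
    with sub t show ?thesis
      by (intro bexI[of _ t] card_subset_eq) (auto intro: finite_subset[OF F.paley_subset])
  qed
  obtain s where s: "s \<in> carrier F" "(\<lambda>b. b \<oplus>\<^bsub>F\<^esub> s) ` fst ` B = F.paley (- 1)"
    using translate[of "\<one>\<^bsub>K\<^esub>"] by auto
  \<comment> \<open>The square \<open>\<one>\<close> has given the nonsquare section; a nonsquare of
    \<open>K\<close>, which exists because only half of the nonzero elements are squares, gives the
    other one.\<close>
  obtain n where n: "n \<in> carrier K" "n \<noteq> \<zero>\<^bsub>K\<^esub>" "K.\<chi> n = - 1"
  proof -
    have "\<exists>n\<in>carrier K. n \<noteq> \<zero>\<^bsub>K\<^esub> \<and> n \<notin> nonzero_squares K"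
    proof (rule ccontr)
      assume "\<not> ?thesis"
      then have "nonzero_squares K = carrier K - {\<zero>\<^bsub>K\<^esub>}"
        using K.nonzero_squares_subset by auto
      then show False
        using K.card_nonzero_squares K.order_ge_3 by (simp add: order_def)
    qed
    with that show thesis by (auto simp: quad_char_def)
  qed
  obtain t where t: "t \<in> carrier F" "(\<lambda>b. b \<oplus>\<^bsub>F\<^esub> t) ` fst ` B = F.paley 1"
    using translate[OF n(1,2)] n(3) by auto
  have fstB: "fst ` B \<subseteq> carrier F" using BH by auto
  show ?thesis
  proof (rule F.order_eq_3_if_paley_translate)
    \<comment> \<open>Shifting by \<open>t - s\<close> carries the translate of \<open>B\<close> by
      \<open>s\<close> to its translate by \<open>t\<close>, that is, \<open>paley (- 1)\<close> to
      \<open>paley 1\<close>.\<close>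
    show "\<ominus>\<^bsub>F\<^esub> s \<oplus>\<^bsub>F\<^esub> t \<in> carrier F" using s t by simp
    fix x assume x: "x \<in> carrier F"
    have mem: "v \<in> (\<lambda>b. b \<oplus>\<^bsub>F\<^esub> r) ` fst ` B \<longleftrightarrow> v \<ominus>\<^bsub>F\<^esub> r \<in> fst ` B"
      if "r \<in> carrier F" "v \<in> carrier F" for r v
    proof
      assume "v \<in> (\<lambda>b. b \<oplus>\<^bsub>F\<^esub> r) ` fst ` B"
      then obtain b where "b \<in> fst ` B" "v = b \<oplus>\<^bsub>F\<^esub> r" by auto
      moreover from this have "v \<ominus>\<^bsub>F\<^esub> r = b"
        using fstB that by (auto simp: a_minus_def F.a_assoc F.r_neg)
      ultimately show "v \<ominus>\<^bsub>F\<^esub> r \<in> fst ` B" by simp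
    next
      assume "v \<ominus>\<^bsub>F\<^esub> r \<in> fst ` B"
      then show "v \<in> (\<lambda>b. b \<oplus>\<^bsub>F\<^esub> r) ` fst ` B"
        using that by (intro image_eqI[of _ _ "v \<ominus>\<^bsub>F\<^esub> r"]) (auto simp: a_minus_def F.a_assoc F.l_neg)
    qed
    have "(x \<oplus>\<^bsub>F\<^esub> (\<ominus>\<^bsub>F\<^esub> s \<oplus>\<^bsub>F\<^esub> t)) \<ominus>\<^bsub>F\<^esub> t = x \<ominus>\<^bsub>F\<^esub> s"
      using x s(1) t(1) by (simp add: a_minus_def F.a_assoc F.r_neg)
    then show "x \<oplus>\<^bsub>F\<^esub> (\<ominus>\<^bsub>F\<^esub> s \<oplus>\<^bsub>F\<^esub> t) \<in> F.paley 1 \<longleftrightarrow> x \<in> F.paley (- 1)"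
      using mem[OF s(1) x] mem[OF t(1), of "x \<oplus>\<^bsub>F\<^esub> (\<ominus>\<^bsub>F\<^esub> s \<oplus>\<^bsub>F\<^esub> t)"] s t x by simp
  qed
qed

end

theorem theorem4p6:
  fixes Q :: nat
    and F :: "('a, 'm) ring_scheme"
    and K :: "('b, 'n) ring_scheme"
  assumes "odd Q" and "primepow Q" and "primepow (Q + 2)"
    and "field F" and "order F = Q"
    and "field K" and "order K = Q + 2"
  shows "real (card (twin_set F K)) = (real Q + 1)\<^sup>2 / 2
    \<and> twin_set F K = carrier (twin_group F K) - classical_twin_set F K
    \<and> fine (twin_group F K) (twin_set F K)
    \<and> (amalgam (twin_group F K) (twin_set F K) \<longleftrightarrow> Q mod 4 = 3)
    \<and> (composite (twin_group F K) (twin_set F K) \<longrightarrow> Q = 3)"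
proof -
  interpret F: odd_field F using assms by (simp add: odd_field_def odd_field_axioms_def)
  interpret K: odd_field K using assms by (simp add: odd_field_def odd_field_axioms_def)
  interpret twin_fields F K using assms by unfold_locales simp
  have "real (card (twin_set F K)) = (real Q + 1)\<^sup>2 / 2"
    using arg_cong[OF card_twin_set, of real] assms(5) by (simp add: add_ac mult_ac)
  moreover have "fine (twin_group F K) (twin_set F K)"
    by (simp add: fine_def fine_wrt_twin_iff)
  ultimately show ?thesis
    using twin_set_eq_complement amalgam_twin_iff composite_twin assms(5) by blast
qed

end
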